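(* Let $Q$ be a finite non-simple connected quandle. The following are equivalent: (i) $Q$ is locally strictly simple (LSS). (ii) $Q/\alpha$ and $[a]_\alpha$ are strictly simple quandles for every congruence $\alpha$ of $Q$ with $\alpha\ne 0_Q,1_Q$ and every $a\in Q$. (iii) There exists a congruence $\alpha$ of $Q$ such that $Q/\alpha$ and $[a]_\alpha$ are strictly simple quandles for every $a\in Q$.
   Context: A quandle is a set $Q$ with a binary operation $*$ such that every left translation $L_a:b\mapsto a*b$ is a bijection, $a*(b*c)=(a*b)*(a*c)$ and $a*a=a$. $Q$ is connected if the group generated by all $L_a$ is transitive on $Q$. Subquandles are subsets closed under $*$ and left division; congruences are equivalence relations compatible with $*$ and left division; $0_Q$ is equality and $1_Q=Q\times Q$; $[a]_\alpha$ is the block of $a$ (a subquandle). $Q$ is simple if it has no congruences other than $0_Q,1_Q$. A subquandle is proper if it has more than one element and is not all of $Q$. A quandle (with more than one element) is strictly simple if it has no proper subquandles, and locally strictly simple (LSS) if all its proper subquandles are strictly simple. *)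

theory Defs
  imports "HOL-Algebra.Bij" "HOL-Algebra.Generated_Groups"
begin

text \<open>A quandle is a carrier set \<open>Q\<close> with an operation \<open>f\<close>; only the values of \<open>f\<close> on \<open>Q\<close> matter.
  The left translation \<open>L_a\<close> is \<open>f a\<close> on \<open>Q\<close>.\<close>

locale quandle =
  fixes Q :: "'a set" and f :: "'a \<Rightarrow> 'a \<Rightarrow> 'a"
  assumes bij_translation: "a \<in> Q \<Longrightarrow> bij_betw (f a) Q Q"
    and self_distrib: "\<lbrakk>a \<in> Q; b \<in> Q; c \<in> Q\<rbrakk> \<Longrightarrow> f a (f b c) = f (f a b) (f a c)"
    and idem: "a \<in> Q \<Longrightarrow> f a a = a"

definition ldiv :: "'a set \<Rightarrow> ('a \<Rightarrow> 'a \<Rightarrow> 'a) \<Rightarrow> 'a \<Rightarrow> 'a \<Rightarrow> 'a" where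
  "ldiv Q f a b = inv_into Q (f a) b"

text \<open>\<open>BijGroup Q\<close> consists of bijections that are extensional on \<open>Q\<close>, hence the \<open>restrict\<close>.\<close>

definition left_mult_group :: "'a set \<Rightarrow> ('a \<Rightarrow> 'a \<Rightarrow> 'a) \<Rightarrow> ('a \<Rightarrow> 'a) set" where
  "left_mult_group Q f = generate (BijGroup Q) ((\<lambda>a. restrict (f a) Q) ` Q)"

definition connected_quandle :: "'a set \<Rightarrow> ('a \<Rightarrow> 'a \<Rightarrow> 'a) \<Rightarrow> bool" where
  "connected_quandle Q f \<longleftrightarrow>
     quandle Q f \<and> (\<forall>x\<in>Q. \<forall>y\<in>Q. \<exists>g\<in>left_mult_group Q f. g x = y)"

definition subquandle :: "'a set \<Rightarrow> 'a set \<Rightarrow> ('a \<Rightarrow> 'a \<Rightarrow> 'a) \<Rightarrow> bool" where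
  "subquandle S Q f \<longleftrightarrow>
     S \<subseteq> Q \<and> (\<forall>a\<in>S. \<forall>b\<in>S. f a b \<in> S \<and> ldiv Q f a b \<in> S)"

definition more_than_one :: "'a set \<Rightarrow> bool" where
  "more_than_one S \<longleftrightarrow> (\<exists>x\<in>S. \<exists>y\<in>S. x \<noteq> y)"

definition proper_subquandle :: "'a set \<Rightarrow> 'a set \<Rightarrow> ('a \<Rightarrow> 'a \<Rightarrow> 'a) \<Rightarrow> bool" where
  "proper_subquandle S Q f \<longleftrightarrow> subquandle S Q f \<and> more_than_one S \<and> S \<noteq> Q"

definition quandle_congruence :: "('a \<times> 'a) set \<Rightarrow> 'a set \<Rightarrow> ('a \<Rightarrow> 'a \<Rightarrow> 'a) \<Rightarrow> bool" where
  "quandle_congruence \<alpha> Q f \<longleftrightarrow>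
     equiv Q \<alpha> \<and>
     (\<forall>(a, a')\<in>\<alpha>. \<forall>(b, b')\<in>\<alpha>.
        (f a b, f a' b') \<in> \<alpha> \<and> (ldiv Q f a b, ldiv Q f a' b') \<in> \<alpha>)"

text \<open>The quotient has carrier \<open>Q // \<alpha>\<close>. The operation below is the usual one on blocks when
  \<open>\<alpha>\<close> is a congruence, see \<open>quotient_op_class\<close>.\<close>

definition quotient_op ::
  "('a \<times> 'a) set \<Rightarrow> ('a \<Rightarrow> 'a \<Rightarrow> 'a) \<Rightarrow> 'a set \<Rightarrow> 'a set \<Rightarrow> 'a set" where
  "quotient_op \<alpha> f X Y = (\<Union>x\<in>X. \<Union>y\<in>Y. \<alpha> `` {f x y})"

lemma quotient_op_class:
  assumes "quandle_congruence \<alpha> Q f" "a \<in> Q" "b \<in> Q"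
  shows "quotient_op \<alpha> f (\<alpha> `` {a}) (\<alpha> `` {b}) = \<alpha> `` {f a b}"
proof -
  have eq: "equiv Q \<alpha>" using assms(1) by (simp add: quandle_congruence_def)
  have "congruent2 \<alpha> \<alpha> (\<lambda>x y. \<alpha> `` {f x y})"
    unfolding congruent2_def using assms(1) equiv_class_eq[OF eq]
    by (fastforce simp: quandle_congruence_def)
  from UN_equiv_class2[OF eq eq this assms(2,3)] show ?thesis
    by (simp add: quotient_op_def)
qed

definition simple_quandle :: "'a set \<Rightarrow> ('a \<Rightarrow> 'a \<Rightarrow> 'a) \<Rightarrow> bool" where
  "simple_quandle Q f \<longleftrightarrow>
     quandle Q f \<and> (\<forall>\<alpha>. quandle_congruence \<alpha> Q f \<longrightarrow> \<alpha> = Id_on Q \<or> \<alpha> = Q \<times> Q)"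

definition strictly_simple :: "'a set \<Rightarrow> ('a \<Rightarrow> 'a \<Rightarrow> 'a) \<Rightarrow> bool" where
  "strictly_simple Q f \<longleftrightarrow>
     quandle Q f \<and> more_than_one Q \<and> (\<nexists>S. proper_subquandle S Q f)"

definition locally_strictly_simple :: "'a set \<Rightarrow> ('a \<Rightarrow> 'a \<Rightarrow> 'a) \<Rightarrow> bool" where
  "locally_strictly_simple Q f \<longleftrightarrow>
     quandle Q f \<and> (\<forall>S. proper_subquandle S Q f \<longrightarrow> strictly_simple S f)"

end

theory Submission imports Defs begin

text \<open>The implications are proved in the cycle (i), (ii), (iii), (i). The step from (ii) to (iii) is
  immediate, since a quandle that is not simple has a congruence as in (ii). Two ideas carry the rest.

  First, a subquandle of \<open>Q\<close> has a subquandle of \<open>Q/\<alpha>\<close> as its image, and conversely the union of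
  the blocks in a subquandle of \<open>Q/\<alpha>\<close> is a subquandle of \<open>Q\<close>. So if the blocks
  of \<open>\<alpha>\<close> have more than one element, a proper subquandle of \<open>Q/\<alpha>\<close> yields a proper subquandle of
  \<open>Q\<close> that has a block as a proper subquandle, against (i). And if \<open>Q/\<alpha>\<close> is strictly simple, then a
  subquandle of \<open>Q\<close> lies in a single block or meets all of them (\<open>subquandle_in_block_or_meets_all\<close>).

  Second, in a connected quandle a property of points that is preserved in both directions by all
  translations holds everywhere or nowhere (\<open>connected_invariant\<close>). For the property that the block
  of \<open>x\<close> is a singleton, this shows that a nontrivial congruence has no singleton blocks. For the
  property that the block of \<open>x\<close> is contained in a given subquandle \<open>S\<close>, it applies as soon as
  \<open>S\<close> meets every block: translation by any \<open>q\<close> acts on blocks like translation by an element of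
  \<open>S\<close> in the block of \<open>q\<close>, and the latter preserves \<open>S\<close>. So if such an \<open>S\<close> contains one block,
  it is all of \<open>Q\<close>.

  Now let \<open>\<alpha>\<close> be as in (iii) and \<open>S\<close> a proper subquandle. If \<open>S\<close> lies in one block, it is that block.
  Otherwise it meets every block. It contains none of them, so it meets each of them
  in exactly one point, because the blocks have no proper subquandles. Hence \<open>S\<close> is a transversal of
  \<open>\<alpha>\<close>, so it is isomorphic to \<open>Q/\<alpha>\<close> and inherits strict simplicity.\<close>

section \<open>Quandles, subquandles and left division\<close>

context quandle
begin

lemma translation_closed: "a \<in> Q \<Longrightarrow> b \<in> Q \<Longrightarrow> f a b \<in> Q"
  using bij_translation by (meson bij_betwE)

lemma translation_cancel: "\<lbrakk>a \<in> Q; b \<in> Q; c \<in> Q\<rbrakk> \<Longrightarrow> f a b = f a c \<longleftrightarrow> b = c"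
  using bij_translation by (meson bij_betw_imp_inj_on inj_on_eq_iff)

lemma translation_surj:
  assumes "a \<in> Q" "c \<in> Q"
  shows "\<exists>b\<in>Q. f a b = c"
  using bij_betw_imp_surj_on[OF bij_translation[OF assms(1)]] assms(2) by (metis imageE)

lemma ldiv_translation: "a \<in> Q \<Longrightarrow> b \<in> Q \<Longrightarrow> ldiv Q f a (f a b) = b"
  unfolding ldiv_def using bij_translation by (meson bij_betw_imp_inj_on inv_into_f_f)

text \<open>Closure under the operation and under left division combine into a single equivalence. In this
  form, left division, which depends on the ambient quandle, disappears.\<close>

lemma subquandle_iff:
  "subquandle S Q f \<longleftrightarrow> S \<subseteq> Q \<and> (\<forall>a\<in>S. \<forall>b\<in>Q. f a b \<in> S \<longleftrightarrow> b \<in> S)"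
proof
  assume "subquandle S Q f"
  then show "S \<subseteq> Q \<and> (\<forall>a\<in>S. \<forall>b\<in>Q. f a b \<in> S \<longleftrightarrow> b \<in> S)"
    unfolding subquandle_def by (metis ldiv_translation subsetD)
next
  assume S: "S \<subseteq> Q \<and> (\<forall>a\<in>S. \<forall>b\<in>Q. f a b \<in> S \<longleftrightarrow> b \<in> S)"
  have "ldiv Q f a b \<in> S" if "a \<in> S" "b \<in> S" for a b
  proof -
    obtain c where "c \<in> Q" "f a c = b"
      using translation_surj[of a b] S \<open>a \<in> S\<close> \<open>b \<in> S\<close> by blast
    then show ?thesis using S that ldiv_translation by auto
  qed
  then show "subquandle S Q f" using S unfolding subquandle_def by blast
qed

lemma subquandle_quandle:
  assumes "subquandle S Q f"
  shows "quandle S f"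
proof
  have S: "S \<subseteq> Q" "\<And>a b. a \<in> S \<Longrightarrow> b \<in> Q \<Longrightarrow> f a b \<in> S \<longleftrightarrow> b \<in> S"
    using assms unfolding subquandle_iff by auto
  show "bij_betw (f a) S S" if "a \<in> S" for a
    unfolding bij_betw_def
  proof
    show "inj_on (f a) S"
      using that S(1) bij_translation bij_betw_imp_inj_on inj_on_subset by blast
    show "f a ` S = S"
    proof
      show "f a ` S \<subseteq> S"
      proof (rule image_subsetI)
        fix b assume "b \<in> S"
        then have "b \<in> Q" using S(1) by (rule rev_subsetD)
        show "f a b \<in> S" using S(2)[OF that \<open>b \<in> Q\<close>] \<open>b \<in> S\<close> by (rule iffD2)
      qed
      show "S \<subseteq> f a ` S"
      proof
        fix c assume "c \<in> S"
        then obtain b where "b \<in> Q" "f a b = c" using S(1) \<open>a \<in> S\<close> translation_surj[of a c] by blast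
        moreover from this have "b \<in> S" using S(2)[OF that, of b] \<open>c \<in> S\<close> by simp
        ultimately show "c \<in> f a ` S" by blast
      qed
    qed
  qed
  show "f a (f b c) = f (f a b) (f a c)" if "a \<in> S" "b \<in> S" "c \<in> S" for a b c
    using that S(1) by (intro self_distrib) auto
  show "f a a = a" if "a \<in> S" for a
    using that S(1) idem by blast
qed

lemma subquandle_of_subquandle_iff:
  assumes "subquandle S Q f" "T \<subseteq> S"
  shows "subquandle T S f \<longleftrightarrow> subquandle T Q f"
proof -
  interpret S: quandle S f using assms(1) by (rule subquandle_quandle)
  show ?thesis
    using assms unfolding subquandle_iff S.subquandle_iff by (meson subset_iff)
qed

lemma subquandle_Int:
  "subquandle S Q f \<Longrightarrow> subquandle T Q f \<Longrightarrow> subquandle (S \<inter> T) Q f"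
  unfolding subquandle_iff by blast

lemma strictly_simple_subquandle_iff:
  assumes "subquandle S Q f"
  shows "strictly_simple S f \<longleftrightarrow>
    more_than_one S \<and> (\<forall>T\<subseteq>S. subquandle T Q f \<and> more_than_one T \<longrightarrow> T = S)"
proof -
  interpret S: quandle S f using assms by (rule subquandle_quandle)
  have "proper_subquandle T S f \<longleftrightarrow>
      T \<subseteq> S \<and> subquandle T Q f \<and> more_than_one T \<and> T \<noteq> S" for T
    unfolding proper_subquandle_def
    using subquandle_of_subquandle_iff[OF assms] S.subquandle_iff by blast
  then show ?thesis
    unfolding strictly_simple_def using S.quandle_axioms by blast
qed

section \<open>Invariant properties of connected quandles\<close>

text \<open>Membership of \<open>g\<close> in \<open>Bij Q\<close> is part of the induction: composition and inversion in \<open>BijGroup Q\<close>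
  are evaluated by rules that hold only for bijections of \<open>Q\<close>. The hypothesis is an equivalence since
  the group also contains the inverse translations.\<close>

lemma left_mult_group_invariant:
  assumes "g \<in> left_mult_group Q f"
    and inv: "\<And>q x. \<lbrakk>q \<in> Q; x \<in> Q\<rbrakk> \<Longrightarrow> P (f q x) \<longleftrightarrow> P x"
  shows "g \<in> Bij Q \<and> (\<forall>x\<in>Q. P (g x) \<longleftrightarrow> P x)"
proof -
  interpret G: group "BijGroup Q" by (rule group_BijGroup)
  have gen: "restrict (f q) Q \<in> Bij Q" if "q \<in> Q" for q
    using bij_translation[OF that] by (simp add: Bij_def cong: bij_betw_cong)
  from assms(1) show ?thesis
    unfolding left_mult_group_def
  proof induction
    case one
    have "\<one>\<^bsub>BijGroup Q\<^esub> = (\<lambda>x\<in>Q. x)" by (simp add: BijGroup_def)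
    then show ?case using id_Bij by (metis restrict_apply')
  next
    case (incl h)
    then show ?case using gen inv by auto
  next
    case (inv h)
    then obtain q where q: "q \<in> Q" and h: "h = restrict (f q) Q" by auto
    have eq: "inv\<^bsub>BijGroup Q\<^esub> h = restrict (inv_into Q h) Q"
      using gen[OF q] by (simp add: h inv_BijGroup)
    have "P (inv_into Q h x) \<longleftrightarrow> P x" if x: "x \<in> Q" for x
    proof -
      have surj: "h ` Q = Q" using gen[OF q] by (simp add: h Bij_def bij_betw_def)
      have "inv_into Q h x \<in> Q" "h (inv_into Q h x) = x"
        using x surj by (auto intro: inv_into_into f_inv_into_f)
      then show ?thesis using assms(2)[OF q] by (metis h restrict_apply')
    qed
    then have "\<forall>x\<in>Q. P (restrict (inv_into Q h) Q x) \<longleftrightarrow> P x" by simp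
    moreover have "restrict (inv_into Q h) Q \<in> Bij Q"
      unfolding h by (rule restrict_inv_into_Bij[OF gen[OF q]])
    ultimately show ?case unfolding eq by (rule conjI[rotated])
  next
    case (eng h1 h2)
    then have "h2 x \<in> Q" if "x \<in> Q" for x
      using that by (auto simp: Bij_def dest: bij_betwE)
    with eng show ?case
      by (simp add: BijGroup_def compose_Bij compose_eq)
  qed
qed

lemma connected_invariant:
  assumes "connected_quandle Q f"
    and "\<And>q x. \<lbrakk>q \<in> Q; x \<in> Q\<rbrakk> \<Longrightarrow> P (f q x) \<longleftrightarrow> P x"
    and "x \<in> Q" "y \<in> Q" "P x"
  shows "P y"
proof -
  obtain g where "g \<in> left_mult_group Q f" "g x = y"
    using assms(1,3,4) unfolding connected_quandle_def by blast
  then show ?thesis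
    using left_mult_group_invariant[of g P] assms(2,3,5) by blast
qed

end

section \<open>Congruences, blocks and quotients\<close>

locale congruence = quandle +
  fixes \<alpha> :: "('a \<times> 'a) set"
  assumes congruence: "quandle_congruence \<alpha> Q f"
begin

lemma equivalence: "equiv Q \<alpha>"
  using congruence by (simp add: quandle_congruence_def)

lemma related_carrier: "(a, b) \<in> \<alpha> \<Longrightarrow> a \<in> Q \<and> b \<in> Q"
  using equivalence by (auto simp: equiv_def refl_on_def)

lemma related_refl: "a \<in> Q \<Longrightarrow> (a, a) \<in> \<alpha>"
  using equivalence by (auto simp: equiv_def refl_on_def)

lemma related_sym: "(a, b) \<in> \<alpha> \<Longrightarrow> (b, a) \<in> \<alpha>"
  using equivalence by (auto simp: equiv_def dest: symD)

lemma related_trans: "(a, b) \<in> \<alpha> \<Longrightarrow> (b, c) \<in> \<alpha> \<Longrightarrow> (a, c) \<in> \<alpha>"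
  using equivalence by (auto simp: equiv_def dest: transD)

lemma block_eq_iff: "a \<in> Q \<Longrightarrow> b \<in> Q \<Longrightarrow> \<alpha> `` {a} = \<alpha> `` {b} \<longleftrightarrow> (a, b) \<in> \<alpha>"
  using eq_equiv_class_iff[OF equivalence] .

lemma block_nonempty: "a \<in> Q \<Longrightarrow> a \<in> \<alpha> `` {a}"
  using related_refl by blast

lemma block_subset: "\<alpha> `` {a} \<subseteq> Q"
  using related_carrier by blast

text \<open>As for subquandles, compatibility with left division is the converse direction of compatibility
  with the operation.\<close>

lemma related_translation_iff:
  assumes "(a, a') \<in> \<alpha>" "b \<in> Q" "b' \<in> Q"
  shows "(f a b, f a' b') \<in> \<alpha> \<longleftrightarrow> (b, b') \<in> \<alpha>"
proof
  assume "(b, b') \<in> \<alpha>"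
  with assms(1) show "(f a b, f a' b') \<in> \<alpha>"
    using congruence unfolding quandle_congruence_def by fast
next
  assume "(f a b, f a' b') \<in> \<alpha>"
  with assms(1) have "(ldiv Q f a (f a b), ldiv Q f a' (f a' b')) \<in> \<alpha>"
    using congruence unfolding quandle_congruence_def by fast
  then show "(b, b') \<in> \<alpha>"
    using assms related_carrier ldiv_translation by metis
qed

lemma block_subquandle:
  assumes "a \<in> Q"
  shows "subquandle (\<alpha> `` {a}) Q f"
  unfolding subquandle_iff
proof (intro conjI ballI)
  show "\<alpha> `` {a} \<subseteq> Q" by (rule block_subset)
  fix x b assume x: "x \<in> \<alpha> `` {a}" and b: "b \<in> Q"
  \<comment> \<open>Idempotence lets \<open>f a a\<close> stand in for \<open>a\<close>.\<close>
  have "(f a a, f x b) \<in> \<alpha> \<longleftrightarrow> (a, b) \<in> \<alpha>"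
    using related_translation_iff x b assms by blast
  then show "f x b \<in> \<alpha> `` {a} \<longleftrightarrow> b \<in> \<alpha> `` {a}"
    using idem assms by simp
qed

lemma translation_block:
  assumes "q \<in> Q" "x \<in> Q"
  shows "\<alpha> `` {f q x} = f q ` (\<alpha> `` {x})"
proof
  show "f q ` (\<alpha> `` {x}) \<subseteq> \<alpha> `` {f q x}"
    using related_translation_iff[OF related_refl] assms related_carrier by blast
  show "\<alpha> `` {f q x} \<subseteq> f q ` (\<alpha> `` {x})"
  proof
    fix z assume z: "z \<in> \<alpha> `` {f q x}"
    then obtain y where "y \<in> Q" "f q y = z"
      using translation_surj[OF assms(1)] block_subset by blast
    with z show "z \<in> f q ` (\<alpha> `` {x})"
      using related_translation_iff[OF related_refl] assms by blast
  qed
qed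

text \<open>By \<open>translation_block\<close>, translations map singleton blocks to singleton blocks and reflect them,
  so one singleton block would force all blocks to be singletons.\<close>

lemma nontrivial_block_more_than_one:
  assumes "connected_quandle Q f" "\<alpha> \<noteq> Id_on Q" "a \<in> Q"
  shows "more_than_one (\<alpha> `` {a})"
proof (rule ccontr)
  define P where "P x \<longleftrightarrow> \<alpha> `` {x} = {x}" for x
  assume "\<not> more_than_one (\<alpha> `` {a})"
  then have "P a" using block_nonempty[OF assms(3)] unfolding P_def more_than_one_def by blast
  have inv: "P (f q x) \<longleftrightarrow> P x" if "q \<in> Q" "x \<in> Q" for q x
  proof
    assume "P x"
    then show "P (f q x)" using translation_block[OF that] by (simp add: P_def)
  next
    assume P: "P (f q x)"
    have "y = x" if "(x, y) \<in> \<alpha>" for y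
    proof -
      have "f q y = f q x"
        using P translation_block[OF \<open>q \<in> Q\<close> \<open>x \<in> Q\<close>] that unfolding P_def by blast
      then show ?thesis
        using translation_cancel related_carrier[OF that] \<open>q \<in> Q\<close> by blast
    qed
    then show "P x" using related_refl[OF \<open>x \<in> Q\<close>] unfolding P_def by blast
  qed
  have "P x" if "x \<in> Q" for x
    using connected_invariant[of P, OF assms(1) inv assms(3) that \<open>P a\<close>] by simp
  then have "(x, y) \<in> \<alpha> \<longleftrightarrow> x \<in> Q \<and> y = x" for x y
    unfolding P_def using related_carrier by blast
  then have "\<alpha> = Id_on Q" by auto
  with assms(2) show False ..
qed

abbreviation quotient_operation where "quotient_operation \<equiv> quotient_op \<alpha> f"

lemma quotient_operation_block:
  "a \<in> Q \<Longrightarrow> b \<in> Q \<Longrightarrow> quotient_operation (\<alpha> `` {a}) (\<alpha> `` {b}) = \<alpha> `` {f a b}"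
  using quotient_op_class[OF congruence] .

lemma quotient_quandle: "quandle (Q // \<alpha>) quotient_operation"
proof
  fix A assume "A \<in> Q // \<alpha>"
  then obtain a where a: "a \<in> Q" and A: "A = \<alpha> `` {a}" by (auto elim: quotientE)
  show "quotient_operation A A = A"
    using a by (simp add: A quotient_operation_block idem)
  show "bij_betw (quotient_operation A) (Q // \<alpha>) (Q // \<alpha>)"
    unfolding bij_betw_def
  proof
    show "inj_on (quotient_operation A) (Q // \<alpha>)"
    proof (rule inj_onI)
      fix B C assume "B \<in> Q // \<alpha>" "C \<in> Q // \<alpha>"
        and eq: "quotient_operation A B = quotient_operation A C"
      then obtain b c where bc: "b \<in> Q" "c \<in> Q" and B: "B = \<alpha> `` {b}" and C: "C = \<alpha> `` {c}"
        by (auto elim!: quotientE)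
      have "(f a b, f a c) \<in> \<alpha>"
        using eq a bc by (simp add: A B C quotient_operation_block block_eq_iff translation_closed)
      then show "B = C"
        using related_translation_iff[OF related_refl[OF a]] bc by (simp add: B C block_eq_iff)
    qed
    show "quotient_operation A ` (Q // \<alpha>) = Q // \<alpha>"
    proof (intro equalityI subsetI)
      fix C assume "C \<in> quotient_operation A ` (Q // \<alpha>)"
      then obtain b where "b \<in> Q" "C = \<alpha> `` {f a b}"
        using a by (auto simp: A quotient_operation_block elim!: quotientE)
      then show "C \<in> Q // \<alpha>" using a translation_closed by (simp add: quotientI)
    next
      fix C assume "C \<in> Q // \<alpha>"
      then obtain c where "c \<in> Q" and C: "C = \<alpha> `` {c}" by (auto elim: quotientE)
      then obtain b where "b \<in> Q" "f a b = c" using translation_surj[OF a] by blast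
      then have "C = quotient_operation A (\<alpha> `` {b})"
        using a by (simp add: A C quotient_operation_block)
      then show "C \<in> quotient_operation A ` (Q // \<alpha>)" using \<open>b \<in> Q\<close> by (blast intro: quotientI)
    qed
  qed
next
  fix A B C assume "A \<in> Q // \<alpha>" "B \<in> Q // \<alpha>" "C \<in> Q // \<alpha>"
  then obtain a b c where abc: "a \<in> Q" "b \<in> Q" "c \<in> Q"
      and blocks: "A = \<alpha> `` {a}" "B = \<alpha> `` {b}" "C = \<alpha> `` {c}"
    by (auto elim!: quotientE)
  show "quotient_operation A (quotient_operation B C) =
      quotient_operation (quotient_operation A B) (quotient_operation A C)"
    using abc self_distrib[OF abc] by (simp add: blocks quotient_operation_block translation_closed)
qed

sublocale quotient: quandle "Q // \<alpha>" quotient_operation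
  by (rule quotient_quandle)

lemma subquandle_image:
  assumes "subquandle S Q f"
  shows "subquandle ((\<lambda>x. \<alpha> `` {x}) ` S) (Q // \<alpha>) quotient_operation"
  unfolding quotient.subquandle_iff
proof (intro conjI ballI)
  have S: "S \<subseteq> Q" "\<And>a b. a \<in> S \<Longrightarrow> b \<in> Q \<Longrightarrow> f a b \<in> S \<longleftrightarrow> b \<in> S"
    using assms unfolding subquandle_iff by auto
  show "(\<lambda>x. \<alpha> `` {x}) ` S \<subseteq> Q // \<alpha>" using S(1) by (blast intro: quotientI)
  fix A B assume "A \<in> (\<lambda>x. \<alpha> `` {x}) ` S" "B \<in> Q // \<alpha>"
  then obtain s b where s: "s \<in> S" "A = \<alpha> `` {s}" and b: "b \<in> Q" "B = \<alpha> `` {b}"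
    by (auto elim: quotientE)
  have AB: "quotient_operation A B = \<alpha> `` {f s b}"
    using s b S(1) by (auto simp: quotient_operation_block)
  show "quotient_operation A B \<in> (\<lambda>x. \<alpha> `` {x}) ` S \<longleftrightarrow> B \<in> (\<lambda>x. \<alpha> `` {x}) ` S"
  proof
    assume "quotient_operation A B \<in> (\<lambda>x. \<alpha> `` {x}) ` S"
    then obtain t where t: "t \<in> S" "(f s b, t) \<in> \<alpha>"
      using AB s b S(1) by (auto simp: block_eq_iff translation_closed subset_iff)
    obtain u where u: "u \<in> Q" "f s u = t" using translation_surj[of s t] s t S(1) by blast
    then have "u \<in> S" using S(2)[OF s(1), of u] t(1) by simp
    moreover have "(b, u) \<in> \<alpha>"
      using t u s b S(1) related_translation_iff[OF related_refl] by blast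
    ultimately show "B \<in> (\<lambda>x. \<alpha> `` {x}) ` S" using b u block_eq_iff by blast
  next
    assume "B \<in> (\<lambda>x. \<alpha> `` {x}) ` S"
    then obtain t where t: "t \<in> S" "B = \<alpha> `` {t}" by blast
    then have "quotient_operation A B = \<alpha> `` {f s t}" "f s t \<in> S"
      using quotient_operation_block[of s t] s S(1) S(2)[of s t] by auto
    then show "quotient_operation A B \<in> (\<lambda>x. \<alpha> `` {x}) ` S" by blast
  qed
qed

lemma subquandle_preimage:
  assumes "subquandle \<S> (Q // \<alpha>) quotient_operation"
  shows "subquandle {x \<in> Q. \<alpha> `` {x} \<in> \<S>} Q f"
  unfolding subquandle_iff
proof (intro conjI ballI)
  fix a b assume a: "a \<in> {x \<in> Q. \<alpha> `` {x} \<in> \<S>}" and b: "b \<in> Q"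
  then have "\<alpha> `` {a} \<in> \<S>" "\<alpha> `` {b} \<in> Q // \<alpha>" by (auto intro: quotientI)
  with assms have "quotient_operation (\<alpha> `` {a}) (\<alpha> `` {b}) \<in> \<S> \<longleftrightarrow> \<alpha> `` {b} \<in> \<S>"
    unfolding quotient.subquandle_iff by (elim conjE) (drule (1) bspec, drule (1) bspec)
  then show "f a b \<in> {x \<in> Q. \<alpha> `` {x} \<in> \<S>} \<longleftrightarrow> b \<in> {x \<in> Q. \<alpha> `` {x} \<in> \<S>}"
    using a b by (simp add: quotient_operation_block translation_closed)
qed auto

text \<open>The image of \<open>S\<close> in the quotient has at most one element or is the whole quotient.\<close>

lemma subquandle_in_block_or_meets_all:
  assumes "strictly_simple (Q // \<alpha>) quotient_operation" "subquandle S Q f"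
  shows "(\<forall>x\<in>S. \<forall>y\<in>S. (x, y) \<in> \<alpha>) \<or> (\<forall>q\<in>Q. \<exists>s\<in>S. (q, s) \<in> \<alpha>)"
proof -
  have S: "S \<subseteq> Q" using assms(2) by (simp add: subquandle_def)
  let ?T = "(\<lambda>x. \<alpha> `` {x}) ` S"
  have "\<not> proper_subquandle ?T (Q // \<alpha>) quotient_operation"
    using assms(1) unfolding strictly_simple_def by blast
  then have "\<not> more_than_one ?T \<or> ?T = Q // \<alpha>"
    using subquandle_image[OF assms(2)] unfolding proper_subquandle_def by simp
  then show ?thesis
  proof
    assume "\<not> more_than_one ?T"
    then have single: "A = B" if "A \<in> ?T" "B \<in> ?T" for A B
      using that unfolding more_than_one_def by metis
    have "(x, y) \<in> \<alpha>" if "x \<in> S" "y \<in> S" for x y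
    proof -
      have "\<alpha> `` {x} = \<alpha> `` {y}" by (rule single) (rule imageI, rule that)+
      then show ?thesis
        using block_eq_iff[OF subsetD[OF S that(1)] subsetD[OF S that(2)]] by (rule iffD1[rotated])
    qed
    then show ?thesis by simp
  next
    assume eq: "?T = Q // \<alpha>"
    have "\<exists>s\<in>S. (q, s) \<in> \<alpha>" if "q \<in> Q" for q
    proof -
      have "\<alpha> `` {q} \<in> ?T" using that by (simp only: eq quotientI)
      then obtain s where "s \<in> S" "\<alpha> `` {q} = \<alpha> `` {s}" by blast
      then show ?thesis using S that block_eq_iff[of q s] by blast
    qed
    then show ?thesis by blast
  qed
qed

section \<open>Subquandles meeting every block\<close>

lemma block_translation_subset_iff:
  assumes "subquandle S Q f" "s \<in> S" "x \<in> Q"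
  shows "\<alpha> `` {f s x} \<subseteq> S \<longleftrightarrow> \<alpha> `` {x} \<subseteq> S"
proof -
  have S: "s \<in> Q" "\<And>b. b \<in> Q \<Longrightarrow> f s b \<in> S \<longleftrightarrow> b \<in> S"
    using assms(1,2) unfolding subquandle_iff by auto
  have "f s y \<in> S \<longleftrightarrow> y \<in> S" if "y \<in> \<alpha> `` {x}" for y
    using S(2)[of y] that block_subset by blast
  then show ?thesis
    unfolding translation_block[OF S(1) assms(3)] image_subset_iff by auto
qed

text \<open>The set of points whose block lies in \<open>S\<close> is invariant under translation by elements of \<open>S\<close>. Since
  \<open>S\<close> represents every block and related elements translate a block to the same block, this set is
  invariant under all translations.\<close>

lemma meets_all_contains_block:
  assumes "connected_quandle Q f" "subquandle S Q f"
    and meets: "\<And>q. q \<in> Q \<Longrightarrow> \<exists>s\<in>S. (q, s) \<in> \<alpha>"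
    and "a \<in> Q" "\<alpha> `` {a} \<subseteq> S"
  shows "S = Q"
proof
  show "S \<subseteq> Q" using assms(2) by (simp add: subquandle_def)
  have inv: "\<alpha> `` {f q x} \<subseteq> S \<longleftrightarrow> \<alpha> `` {x} \<subseteq> S" if "q \<in> Q" "x \<in> Q" for q x
  proof -
    obtain s where s: "s \<in> S" "(q, s) \<in> \<alpha>" using meets[OF \<open>q \<in> Q\<close>] by blast
    then have "(f q x, f s x) \<in> \<alpha>"
      using related_translation_iff that(2) related_refl by blast
    then have "\<alpha> `` {f q x} = \<alpha> `` {f s x}"
      using block_eq_iff related_carrier by blast
    then show ?thesis
      using block_translation_subset_iff[OF assms(2) s(1) that(2)] by simp
  qed
  show "Q \<subseteq> S"
  proof
    fix x assume x: "x \<in> Q"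
    have "\<alpha> `` {x} \<subseteq> S"
      using connected_invariant[of "\<lambda>y. \<alpha> `` {y} \<subseteq> S", OF assms(1) inv assms(4) x assms(5)]
      by simp
    then show "x \<in> S" using block_nonempty[OF x] by blast
  qed
qed

text \<open>The projection to the quotient is injective on \<open>S\<close>, and onto since \<open>S\<close> has more than one element
  and the quotient is strictly simple. So the image of a proper subquandle of \<open>S\<close> would be a proper
  subquandle of the quotient.\<close>

lemma transversal_strictly_simple:
  assumes "strictly_simple (Q // \<alpha>) quotient_operation" "subquandle S Q f" "more_than_one S"
    and transversal: "\<And>x y. \<lbrakk>x \<in> S; y \<in> S; (x, y) \<in> \<alpha>\<rbrakk> \<Longrightarrow> x = y"
  shows "strictly_simple S f"
  unfolding strictly_simple_subquandle_iff[OF assms(2)]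
proof (intro conjI allI impI)
  show "more_than_one S" by fact
  fix T assume T: "T \<subseteq> S" "subquandle T Q f \<and> more_than_one T"
  have "S \<subseteq> Q" using assms(2) by (simp add: subquandle_def)
  obtain t t' where "t \<in> T" "t' \<in> T" "t \<noteq> t'"
    using T(2) unfolding more_than_one_def by blast
  then have "\<not> (\<forall>x\<in>T. \<forall>y\<in>T. (x, y) \<in> \<alpha>)"
    using transversal[of t t'] T(1) by blast
  then have meets: "\<exists>t\<in>T. (q, t) \<in> \<alpha>" if "q \<in> Q" for q
    using subquandle_in_block_or_meets_all[OF assms(1)] T that by blast
  have "S \<subseteq> T"
  proof
    fix s assume "s \<in> S"
    then obtain t where "t \<in> T" "(s, t) \<in> \<alpha>" using meets \<open>S \<subseteq> Q\<close> by blast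
    then show "s \<in> T" using transversal T(1) \<open>s \<in> S\<close> by blast
  qed
  with T(1) show "T = S" by blast
qed

section \<open>Locally strictly simple quandles\<close>

lemma locally_strictly_simple_factors:
  assumes "connected_quandle Q f" "locally_strictly_simple Q f"
    and "\<alpha> \<noteq> Id_on Q" "\<alpha> \<noteq> Q \<times> Q"
  shows "strictly_simple (Q // \<alpha>) quotient_operation"
    and "a \<in> Q \<Longrightarrow> strictly_simple (\<alpha> `` {a}) f"
proof -
  obtain b c where bc: "b \<in> Q" "c \<in> Q" "(b, c) \<notin> \<alpha>"
    using assms(4) related_carrier by auto
  have block: "subquandle (\<alpha> `` {a}) Q f" "more_than_one (\<alpha> `` {a})" if "a \<in> Q" for a
    using that assms block_subquandle nontrivial_block_more_than_one by auto
  show "strictly_simple (\<alpha> `` {a}) f" if a: "a \<in> Q" for a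
  proof -
    have "\<alpha> `` {a} \<noteq> Q"
      using bc related_sym related_trans by blast
    then show ?thesis
      using assms(2) block[OF a]
      unfolding locally_strictly_simple_def proper_subquandle_def by blast
  qed
  show "strictly_simple (Q // \<alpha>) quotient_operation"
    unfolding strictly_simple_def
  proof (intro conjI notI)
    show "quandle (Q // \<alpha>) quotient_operation" by (rule quotient_quandle)
    show "more_than_one (Q // \<alpha>)"
      unfolding more_than_one_def using bc block_eq_iff by (meson quotientI)
    assume "\<exists>\<S>. proper_subquandle \<S> (Q // \<alpha>) quotient_operation"
    then obtain \<S> where S: "subquandle \<S> (Q // \<alpha>) quotient_operation"
        "more_than_one \<S>" "\<S> \<noteq> Q // \<alpha>"
      unfolding proper_subquandle_def by blast
    have "\<S> \<subseteq> Q // \<alpha>" using S(1) by (simp add: subquandle_def)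
    obtain x y where x: "x \<in> Q" "\<alpha> `` {x} \<in> \<S>"
        and y: "y \<in> Q" "\<alpha> `` {y} \<in> \<S>" and xy: "(x, y) \<notin> \<alpha>"
    proof -
      obtain A B where AB: "A \<in> \<S>" "B \<in> \<S>" "A \<noteq> B"
        using S(2) unfolding more_than_one_def by blast
      then obtain x y where "x \<in> Q" "A = \<alpha> `` {x}" "y \<in> Q" "B = \<alpha> `` {y}"
        using \<open>\<S> \<subseteq> Q // \<alpha>\<close> by (meson quotientE subsetD)
      with AB show thesis using that block_eq_iff by blast
    qed
    obtain C where "C \<in> Q // \<alpha>" "C \<notin> \<S>" using S(3) \<open>\<S> \<subseteq> Q // \<alpha>\<close> by blast
    then obtain z where z: "z \<in> Q" "\<alpha> `` {z} \<notin> \<S>" by (metis quotientE)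
    let ?U = "{x \<in> Q. \<alpha> `` {x} \<in> \<S>}"
    have U: "subquandle ?U Q f" using S(1) by (rule subquandle_preimage)
    \<comment> \<open>\<open>?U\<close> is not strictly simple: it contains the block of \<open>x\<close>, and \<open>y\<close> outside that block.\<close>
    have block_U: "\<alpha> `` {x} \<subseteq> ?U"
      using x block_eq_iff related_carrier by (auto simp: Image_singleton_iff) metis
    have "x \<noteq> y" using xy x related_refl by blast
    then have "proper_subquandle ?U Q f"
      using U x y z unfolding proper_subquandle_def more_than_one_def by blast
    then have "strictly_simple ?U f"
      using assms(2) unfolding locally_strictly_simple_def by blast
    then have "\<alpha> `` {x} = ?U"
      using strictly_simple_subquandle_iff[OF U] block[OF x(1)] block_U by blast
    with xy y show False by blast
  qed
qed

lemma strictly_simple_factors_imp_locally_strictly_simple: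
  assumes "connected_quandle Q f"
    and quot: "strictly_simple (Q // \<alpha>) quotient_operation"
    and blocks: "\<And>a. a \<in> Q \<Longrightarrow> strictly_simple (\<alpha> `` {a}) f"
  shows "locally_strictly_simple Q f"
  unfolding locally_strictly_simple_def
proof (intro conjI allI impI)
  show "quandle Q f" by (rule quandle_axioms)
  fix S assume "proper_subquandle S Q f"
  then have S: "subquandle S Q f" "more_than_one S" "S \<noteq> Q"
    unfolding proper_subquandle_def by auto
  then have SQ: "S \<subseteq> Q" by (simp add: subquandle_def)
  have trace: "S \<inter> \<alpha> `` {a} = \<alpha> `` {a}" if "a \<in> Q" "more_than_one (S \<inter> \<alpha> `` {a})" for a
    using blocks[OF that(1)] that(2) subquandle_Int[OF S(1) block_subquandle[OF that(1)]]
    unfolding strictly_simple_subquandle_iff[OF block_subquandle[OF that(1)]] by (meson Int_lower2)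
  from subquandle_in_block_or_meets_all[OF quot S(1)] show "strictly_simple S f"
  proof
    assume one: "\<forall>x\<in>S. \<forall>y\<in>S. (x, y) \<in> \<alpha>"
    obtain a where a: "a \<in> S" using S(2) unfolding more_than_one_def by blast
    then have "S \<inter> \<alpha> `` {a} = S" using one by blast
    then have "S = \<alpha> `` {a}" using trace[of a] a S(2) SQ by (metis subsetD)
    then show ?thesis using blocks a SQ by blast
  next
    assume all: "\<forall>q\<in>Q. \<exists>s\<in>S. (q, s) \<in> \<alpha>"
    show ?thesis
    proof (rule transversal_strictly_simple[OF quot S(1,2)], rule ccontr)
      fix x y assume xy: "x \<in> S" "y \<in> S" "(x, y) \<in> \<alpha>" "x \<noteq> y"
      \<comment> \<open>A second point of \<open>S\<close> in the block of \<open>x\<close> forces the whole block into \<open>S\<close>.\<close>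
      then have "more_than_one (S \<inter> \<alpha> `` {x})"
        using related_refl SQ unfolding more_than_one_def by blast
      then have "\<alpha> `` {x} \<subseteq> S" using trace[of x] xy(1) SQ by blast
      then have "S = Q"
        using meets_all_contains_block[OF assms(1) S(1)] all xy(1) SQ by blast
      with S(3) show False ..
    qed
  qed
qed

end

theorem proposition2p4:
  fixes Q :: "'a set" and f :: "'a \<Rightarrow> 'a \<Rightarrow> 'a"
  assumes "finite Q" and "connected_quandle Q f" and "\<not> simple_quandle Q f"
  shows
    "(locally_strictly_simple Q f \<longleftrightarrow>
        (\<forall>\<alpha>. quandle_congruence \<alpha> Q f \<and> \<alpha> \<noteq> Id_on Q \<and> \<alpha> \<noteq> Q \<times> Q \<longrightarrow>
           strictly_simple (Q // \<alpha>) (quotient_op \<alpha> f) \<and>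
           (\<forall>a\<in>Q. strictly_simple (\<alpha> `` {a}) f)))
     \<and>
     ((\<forall>\<alpha>. quandle_congruence \<alpha> Q f \<and> \<alpha> \<noteq> Id_on Q \<and> \<alpha> \<noteq> Q \<times> Q \<longrightarrow>
           strictly_simple (Q // \<alpha>) (quotient_op \<alpha> f) \<and>
           (\<forall>a\<in>Q. strictly_simple (\<alpha> `` {a}) f)) \<longleftrightarrow>
        (\<exists>\<alpha>. quandle_congruence \<alpha> Q f \<and>
           strictly_simple (Q // \<alpha>) (quotient_op \<alpha> f) \<and>
           (\<forall>a\<in>Q. strictly_simple (\<alpha> `` {a}) f)))"
  (is "(?lss \<longleftrightarrow> ?all) \<and> (?all \<longleftrightarrow> ?ex)")
proof -
  interpret quandle Q f using assms(2) unfolding connected_quandle_def by (rule conjunct1)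
  have cong: "congruence Q f \<alpha>" if "quandle_congruence \<alpha> Q f" for \<alpha>
    using quandle_axioms that by (intro congruence.intro congruence_axioms.intro)
  have "?all" if "?lss"
    using congruence.locally_strictly_simple_factors[OF cong assms(2) that] by simp
  moreover have "?ex" if "?all"
    using that assms(3) quandle_axioms unfolding simple_quandle_def by blast
  moreover have "?lss" if "?ex"
    using that congruence.strictly_simple_factors_imp_locally_strictly_simple[OF cong assms(2)]
    by blast
  ultimately show ?thesis by blast
qed

end
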